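(* Let $c_1,c_2\ge 1$ be integers and let $q_{\max_1},q_{\max_2},\lambda>0$ be real numbers. With $P^{(1)}_{c_1}(\lambda,\theta)$ as defined in the context, the equation $$\theta=\lambda\left(1-P^{(1)}_{c_1}(\lambda,\theta)\right)$$ in the unknown $\theta\in[0,\lambda]$ has a solution, and this solution is unique.
   Context: Two road segments in tandem are considered: the upstream road segment (index $j=1$) and the downstream road segment (index $j=2$), cars passing from the upstream one into the downstream one. The road segment with index $j\in\{1,2\}$ has capacity $c_j$ (maximum number of cars, an integer $\ge 1$) and maximum car-flow $q_{\max_j}>0$; $\lambda>0$ is the arrival rate to the upstream road segment, and $\theta$ is the average flow from the upstream road segment to the downstream road segment. For $j\in\{1,2\}$ the flow function (quadratic fundamental diagram) of the road segment with index $j$ is $$q_j(n)=q_{\max_j}\left(1-\left(\frac{c_j-2n+1}{c_j+1}\right)^2\right).$$ The traffic demand of the upstream road segment is $\Delta_1(n)=q_1(n)$ if $0\le n\le \frac{c_1+1}{2}$ and $\Delta_1(n)=q_{\max_1}$ if $\frac{c_1+1}{2}<n\le c_1+1$. The traffic supply of the downstream road segment is $\Sigma_2(n)=q_{\max_2}$ if $0\le n\le \frac{c_2+1}{2}$ and $\Sigma_2(n)=q_2(n)$ if $\frac{c_2+1}{2}<n\le c_2+1$. Normalized service rates: for $1\le i\le c_2$, $g_2(i)=\dfrac{q_2(i)/q_{\max_2}}{i}$; for $1\le i\le c_1$ and $0\le n_2\le c_2$, $g_1(i,n_2)=\dfrac{\min(\Delta_1(i),\Sigma_2(n_2))/q_{\max_1}}{i}$.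 Stationary distribution of the number of cars in the downstream road segment (as a function of $\theta\ge 0$): $$P^{(2)}_{n_2}(\theta)=\frac{(\theta/q_{\max_2})^{n_2}}{\prod_{i=1}^{n_2} i\,g_2(i)}\,P^{(2)}_0(\theta)\quad (1\le n_2\le c_2),\qquad P^{(2)}_0(\theta)=\left(1+\sum_{n=1}^{c_2}\frac{(\theta/q_{\max_2})^{n}}{\prod_{i=1}^{n} i\,g_2(i)}\right)^{-1}.$$ Conditional stationary distribution of the number of cars in the upstream road segment given $n_2$ cars in the downstream road segment ($0\le n_2\le c_2$): $$P^{(1\mid 2)}_{(n_1\mid n_2)}(\lambda)=\frac{(\lambda/q_{\max_1})^{n_1}}{\prod_{i=1}^{n_1} i\,g_1(i,n_2)}\,P^{(1\mid 2)}_{(0\mid n_2)}(\lambda)\quad(1\le n_1\le c_1),\qquad P^{(1\mid 2)}_{(0\mid n_2)}(\lambda)=\left(1+\sum_{n=1}^{c_1}\frac{(\lambda/q_{\max_1})^{n}}{\prod_{i=1}^{n} i\,g_1(i,n_2)}\right)^{-1}.$$ Stationary distribution of the number of cars in the upstream road segment: $$P^{(1)}_{n_1}(\lambda,\theta)=\sum_{n_2=0}^{c_2}P^{(1\mid 2)}_{(n_1\mid n_2)}(\lambda)\,P^{(2)}_{n_2}(\theta),\qquad 0\le n_1\le c_1.$$ *)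

theory Defs
  imports Complex_Main
begin

text \<open>
  Throughout, \<open>c\<close> is a capacity, \<open>q\<close> a maximum car-flow, and an index 1 or 2 refers to the
  upstream or the downstream road segment. Numbers of cars are natural numbers; the
  fundamental diagram, the demand and the supply are functions of a real argument.
\<close>

definition flow :: "nat \<Rightarrow> real \<Rightarrow> real \<Rightarrow> real" where
  "flow c q n = q * (1 - ((real c - 2 * n + 1) / (real c + 1))\<^sup>2)"

text \<open>Demand and supply are meaningful only for \<open>0 \<le> n \<le> c + 1\<close>; outside this range the
  values below are a harmless totalization and are not used.\<close>

definition traffic_demand :: "nat \<Rightarrow> real \<Rightarrow> real \<Rightarrow> real" where
  "traffic_demand c q n = (if n \<le> (real c + 1) / 2 then flow c q n else q)"

definition traffic_supply :: "nat \<Rightarrow> real \<Rightarrow> real \<Rightarrow> real" where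
  "traffic_supply c q n = (if n \<le> (real c + 1) / 2 then q else flow c q n)"

definition g2 :: "nat \<Rightarrow> real \<Rightarrow> nat \<Rightarrow> real" where
  "g2 c2 q2 i = (flow c2 q2 (real i) / q2) / real i"

definition g1 :: "nat \<Rightarrow> nat \<Rightarrow> real \<Rightarrow> real \<Rightarrow> nat \<Rightarrow> nat \<Rightarrow> real" where
  "g1 c1 c2 q1 q2 i n2 =
     (min (traffic_demand c1 q1 (real i)) (traffic_supply c2 q2 (real n2)) / q1) / real i"

definition P2_zero :: "nat \<Rightarrow> real \<Rightarrow> real \<Rightarrow> real" where
  "P2_zero c2 q2 \<theta> =
     inverse (1 + (\<Sum>n = 1..c2. (\<theta> / q2) ^ n / (\<Prod>i = 1..n. real i * g2 c2 q2 i)))"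

text \<open>For \<open>n2 = 0\<close> the power and the empty product below are both 1, so the value is
  \<^const>\<open>P2_zero\<close>, also when \<open>\<theta> = 0\<close>. The same remark applies to \<open>P12\<close>.\<close>

definition P2 :: "nat \<Rightarrow> real \<Rightarrow> real \<Rightarrow> nat \<Rightarrow> real" where
  "P2 c2 q2 \<theta> n2 =
     (\<theta> / q2) ^ n2 / (\<Prod>i = 1..n2. real i * g2 c2 q2 i) * P2_zero c2 q2 \<theta>"

definition P12_zero :: "nat \<Rightarrow> nat \<Rightarrow> real \<Rightarrow> real \<Rightarrow> real \<Rightarrow> nat \<Rightarrow> real" where
  "P12_zero c1 c2 q1 q2 l n2 =
     inverse (1 + (\<Sum>n = 1..c1. (l / q1) ^ n / (\<Prod>i = 1..n. real i * g1 c1 c2 q1 q2 i n2)))"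

text \<open>\<open>P12 c1 c2 q1 q2 l n1 n2\<close> is the probability of \<open>n1\<close> cars upstream given \<open>n2\<close> cars
  downstream, for the arrival rate \<open>l\<close>.\<close>

definition P12 :: "nat \<Rightarrow> nat \<Rightarrow> real \<Rightarrow> real \<Rightarrow> real \<Rightarrow> nat \<Rightarrow> nat \<Rightarrow> real" where
  "P12 c1 c2 q1 q2 l n1 n2 =
     (l / q1) ^ n1 / (\<Prod>i = 1..n1. real i * g1 c1 c2 q1 q2 i n2) * P12_zero c1 c2 q1 q2 l n2"

definition P1 :: "nat \<Rightarrow> nat \<Rightarrow> real \<Rightarrow> real \<Rightarrow> real \<Rightarrow> real \<Rightarrow> nat \<Rightarrow> real" where
  "P1 c1 c2 q1 q2 l \<theta> n1 = (\<Sum>n2 = 0..c2. P12 c1 c2 q1 q2 l n1 n2 * P2 c2 q2 \<theta> n2)"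

end

theory Submission
  imports Defs
begin

text \<open>
  Let \<open>b n\<close> be the probability that the upstream segment is full given \<open>n\<close> cars downstream.
  The supply decreases in \<open>n\<close>, so the upstream service rates decrease in \<open>n\<close> and \<open>b\<close> increases.
  The downstream law has weights proportional to \<open>w n * \<theta> ^ n\<close>, hence is increasing in \<open>\<theta>\<close> for the
  likelihood ratio order, and so the mean of \<open>b\<close> under it increases in \<open>\<theta>\<close>. Therefore the
  right-hand side of the equation is continuous and decreasing in \<open>\<theta>\<close>, with values in
  \<open>[0, \<lambda>]\<close>, and it meets the identity exactly once.
\<close>

text \<open>The factored form shows the zeros 0 and \<open>c + 1\<close> of the parabola, hence its
  sign in between.\<close>

lemma flow_alt: "flow c q n = q * (4 * n * (real c + 1 - n) / (real c + 1)\<^sup>2)"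
proof -
  have "1 - ((real c - 2 * n + 1) / (real c + 1))\<^sup>2
      = ((real c + 1)\<^sup>2 - (real c - 2 * n + 1)\<^sup>2) / (real c + 1)\<^sup>2"
    by (simp add: power_divide diff_divide_distrib)
  also have "(real c + 1)\<^sup>2 - (real c - 2 * n + 1)\<^sup>2 = 4 * n * (real c + 1 - n)"
    by (simp add: power2_eq_square algebra_simps)
  finally show ?thesis unfolding flow_def by simp
qed

lemma flow_pos: "0 < q \<Longrightarrow> 0 < n \<Longrightarrow> n < real c + 1 \<Longrightarrow> 0 < flow c q n"
  unfolding flow_alt by simp

lemma flow_le: "0 \<le> q \<Longrightarrow> flow c q n \<le> q"
  unfolding flow_def by (simp add: mult_left_le)

lemma flow_antimono:
  assumes "0 \<le> q" "(real c + 1) / 2 \<le> m" "m \<le> n"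
  shows "flow c q n \<le> flow c q m"
proof -
  \<comment> \<open>This product is \<open>m * (c + 1 - m) - n * (c + 1 - n)\<close>; its second
    factor is nonnegative because both points lie to the right of the vertex
    \<open>(c + 1) / 2\<close>.\<close>
  have "0 \<le> (n - m) * (n + m - (real c + 1))"
    using assms by (intro mult_nonneg_nonneg) (simp_all add: field_simps)
  then have "4 * n * (real c + 1 - n) \<le> 4 * m * (real c + 1 - m)"
    by (simp add: algebra_simps)
  then show ?thesis
    unfolding flow_alt using assms(1) by (intro mult_left_mono divide_right_mono) auto
qed

lemma traffic_demand_pos:
  assumes "0 < q" "0 < n"
  shows "0 < traffic_demand c q n"
proof (cases "n \<le> (real c + 1) / 2")
  case True
  then have "n < real c + 1" by (simp add: field_simps)
  then show ?thesis using True assms flow_pos by (simp add: traffic_demand_def)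
qed (use assms in \<open>simp add: traffic_demand_def\<close>)

lemma traffic_supply_pos:
  assumes "0 < q" "n < real c + 1"
  shows "0 < traffic_supply c q n"
proof (cases "n \<le> (real c + 1) / 2")
  case False
  then have "0 < n" by (simp add: field_simps)
  then show ?thesis using False assms flow_pos by (simp add: traffic_supply_def)
qed (use assms in \<open>simp add: traffic_supply_def\<close>)

text \<open>Across the switch of branches the value drops from \<open>q\<close>, the maximum of
  \<open>flow\<close>; beyond it \<open>flow\<close> is on its descending side.\<close>

lemma traffic_supply_antimono:
  assumes "0 \<le> q" "m \<le> n"
  shows "traffic_supply c q n \<le> traffic_supply c q m"
  using assms flow_le[of q c n] flow_antimono[of q c m n] by (auto simp: traffic_supply_def)

lemma g2_pos:
  assumes "0 < q" "1 \<le> i" "i \<le> c"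
  shows "0 < g2 c q i"
  using assms flow_pos[of q "real i" c] by (simp add: g2_def)

lemma g1_pos:
  assumes "0 < q1" "0 < q2" "1 \<le> i" "n \<le> c2"
  shows "0 < g1 c1 c2 q1 q2 i n"
  using assms traffic_demand_pos[of q1 "real i" c1] traffic_supply_pos[of q2 "real n" c2]
  by (simp add: g1_def)

lemma g1_antimono:
  assumes "0 < q1" "0 < q2" "m \<le> n"
  shows "g1 c1 c2 q1 q2 i n \<le> g1 c1 c2 q1 q2 i m"
  unfolding g1_def using assms traffic_supply_antimono[of q2 "real m" "real n" c2]
  by (intro divide_right_mono min.mono) auto

text \<open>Stationary law of a birth-death chain on \<open>{0..c}\<close> with constant birth rate
  \<open>x\<close> and death rates \<open>\<mu> i\<close>. Both \<open>P2\<close> and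
  \<open>P12\<close> are of this form, the leading 1 of their normalizations being the term
  \<open>k = 0\<close>.\<close>

definition birth_death :: "nat \<Rightarrow> real \<Rightarrow> (nat \<Rightarrow> real) \<Rightarrow> nat \<Rightarrow> real" where
  "birth_death c x \<mu> n =
     x ^ n / (\<Prod>i = 1..n. \<mu> i) / (\<Sum>k = 0..c. x ^ k / (\<Prod>i = 1..k. \<mu> i))"

lemma birth_death_weight_nonneg:
  fixes \<mu> :: "nat \<Rightarrow> real"
  assumes "0 \<le> x" "\<And>i. 1 \<le> i \<Longrightarrow> i \<le> c \<Longrightarrow> 0 < \<mu> i" "n \<le> c"
  shows "0 \<le> x ^ n / (\<Prod>i = 1..n. \<mu> i)"
  using assms by (intro divide_nonneg_nonneg prod_nonneg) (auto intro: less_imp_le)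

text \<open>The term \<open>k = 0\<close> equals 1, so the sum is positive even for
  \<open>x = 0\<close>.\<close>

lemma birth_death_sum_pos:
  fixes \<mu> :: "nat \<Rightarrow> real"
  assumes "0 \<le> x" "\<And>i. 1 \<le> i \<Longrightarrow> i \<le> c \<Longrightarrow> 0 < \<mu> i"
  shows "0 < (\<Sum>k = 0..c. x ^ k / (\<Prod>i = 1..k. \<mu> i))"
proof -
  have "0 \<le> (\<Sum>k = Suc 0..c. x ^ k / (\<Prod>i = 1..k. \<mu> i))"
    using assms by (intro sum_nonneg birth_death_weight_nonneg[of x c]) auto
  then show ?thesis by (simp add: sum.atLeast_Suc_atMost)
qed

lemma birth_death_nonneg:
  assumes "0 \<le> x" "\<And>i. 1 \<le> i \<Longrightarrow> i \<le> c \<Longrightarrow> 0 < \<mu> i" "n \<le> c"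
  shows "0 \<le> birth_death c x \<mu> n"
  unfolding birth_death_def
  using assms by (intro divide_nonneg_pos[OF birth_death_weight_nonneg[of x c] birth_death_sum_pos])

lemma sum_birth_death:
  assumes "0 \<le> x" "\<And>i. 1 \<le> i \<Longrightarrow> i \<le> c \<Longrightarrow> 0 < \<mu> i"
  shows "(\<Sum>n = 0..c. birth_death c x \<mu> n) = 1"
  using birth_death_sum_pos[of x c \<mu>, OF assms]
  unfolding birth_death_def sum_divide_distrib[symmetric] by simp

lemma birth_death_le_1:
  assumes "0 \<le> x" "\<And>i. 1 \<le> i \<Longrightarrow> i \<le> c \<Longrightarrow> 0 < \<mu> i" "n \<le> c"
  shows "birth_death c x \<mu> n \<le> 1"
  using member_le_sum[of n "{0..c}" "birth_death c x \<mu>"]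
    birth_death_nonneg[of x c \<mu>] sum_birth_death[of x c \<mu>] assms by auto

lemma continuous_on_birth_death:
  assumes "\<And>i. 1 \<le> i \<Longrightarrow> i \<le> c \<Longrightarrow> 0 < \<mu> i"
  shows "continuous_on {0..} (\<lambda>x. birth_death c x \<mu> n)"
proof -
  \<comment> \<open>With the products written as constant factors \<open>inverse\<close>, the
    normalizing sum is the only denominator that must be nonzero; for \<open>n > c\<close> the
    product in the numerator might vanish.\<close>
  have "(\<Sum>k = 0..c. x ^ k * inverse (\<Prod>i = 1..k. \<mu> i)) \<noteq> 0" if "x \<in> {0..}" for x
    using birth_death_sum_pos[of x c \<mu>] assms that unfolding divide_inverse by force
  then show ?thesis
    unfolding birth_death_def divide_inverse[of "_ ^ _"] by (intro continuous_intros ballI)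
qed

text \<open>For \<open>x > 0\<close> the reciprocal of the blocking probability is the sum over
  \<open>n\<close> of the products of \<open>\<mu> i / x\<close> for \<open>n < i \<le> c\<close>,
  which can only shrink when the rates do.\<close>

lemma birth_death_full_mono:
  fixes \<mu> \<mu>' :: "nat \<Rightarrow> real"
  assumes "0 \<le> x" and pos: "\<And>i. 1 \<le> i \<Longrightarrow> i \<le> c \<Longrightarrow> 0 < \<mu>' i"
    and le: "\<And>i. 1 \<le> i \<Longrightarrow> i \<le> c \<Longrightarrow> \<mu>' i \<le> \<mu> i"
  shows "birth_death c x \<mu> c \<le> birth_death c x \<mu>' c"
proof -
  define v where "v \<nu> n = x ^ n / (\<Prod>i = 1..n. \<nu> i)" for \<nu> n
  have pos': "0 < \<mu> i" if "1 \<le> i" "i \<le> c" for i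
    using pos[OF that] le[OF that] by linarith
  have nn: "0 \<le> v \<mu> n" "0 \<le> v \<mu>' n" if "n \<le> c" for n
    unfolding v_def using birth_death_weight_nonneg[of x c, OF assms(1)] pos pos' that by blast+
  \<comment> \<open>Going from \<open>n\<close> to \<open>d\<close> multiplies a weight by
    \<open>x\<close> over each rate in between, a larger factor for smaller rates. The
    cross-multiplied form also covers \<open>x = 0\<close>, where weights vanish.\<close>
  have ratio: "v \<mu> d * v \<mu>' n \<le> v \<mu>' d * v \<mu> n" if "n \<le> d" "d \<le> c" for n d
    using that
  proof (induction d rule: dec_induct)
    case base
    then show ?case by (simp add: mult.commute)
  next
    case (step d)
    have S: "v \<nu> (Suc d) = v \<nu> d * (x / \<nu> (Suc d))" for \<nu> by (simp add: v_def)
    have "x / \<mu> (Suc d) \<le> x / \<mu>' (Suc d)"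
      using assms(1) step.prems pos le pos' by (intro divide_left_mono) auto
    moreover have "0 \<le> x / \<mu> (Suc d)"
      using assms(1) step.prems pos'[of "Suc d"] by simp
    ultimately have "(v \<mu> d * v \<mu>' n) * (x / \<mu> (Suc d)) \<le> (v \<mu>' d * v \<mu> n) * (x / \<mu>' (Suc d))"
      using step nn by (intro mult_mono[of "v \<mu> d * v \<mu>' n"] mult_nonneg_nonneg) auto
    then show ?case by (simp add: S mult_ac)
  qed
  have "v \<mu> c * (\<Sum>n = 0..c. v \<mu>' n) \<le> v \<mu>' c * (\<Sum>n = 0..c. v \<mu> n)"
    unfolding sum_distrib_left using ratio by (intro sum_mono) auto
  moreover have "0 < (\<Sum>n = 0..c. v \<mu> n)" "0 < (\<Sum>n = 0..c. v \<mu>' n)"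
    unfolding v_def using assms(1) pos pos' by (blast intro: birth_death_sum_pos)+
  ultimately show ?thesis
    unfolding birth_death_def v_def[symmetric] by (simp add: divide_simps)
qed

text \<open>Chebyshev's argument: after clearing denominators, the difference of the two means is
  half of a double sum of nonnegative terms, obtained by exchanging the two indices.\<close>

lemma birth_death_mean_mono:
  fixes b \<mu> :: "nat \<Rightarrow> real"
  assumes x: "0 \<le> x" "x \<le> y" and pos: "\<And>i. 1 \<le> i \<Longrightarrow> i \<le> c \<Longrightarrow> 0 < \<mu> i"
    and b: "\<And>m n. m \<le> n \<Longrightarrow> n \<le> c \<Longrightarrow> b m \<le> b n"
  shows "(\<Sum>n = 0..c. b n * birth_death c x \<mu> n) \<le> (\<Sum>n = 0..c. b n * birth_death c y \<mu> n)"
proof -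
  define v where "v z n = z ^ n / (\<Prod>i = 1..n. \<mu> i)" for z n
  \<comment> \<open>A 2 by 2 minor of the two weight sequences; its sign for
    \<open>m \<le> n\<close> expresses the likelihood ratio order.\<close>
  define D where "D n m = v y n * v x m - v x n * v y m" for n m
  have D_nonneg: "0 \<le> D n m" if "m \<le> n" "n \<le> c" for m n
  proof -
    have "x ^ n * y ^ m = (x * y) ^ m * x ^ (n - m)"
      using that by (simp add: power_mult_distrib flip: power_add)
    also have "\<dots> \<le> (x * y) ^ m * y ^ (n - m)"
      using x by (intro mult_left_mono power_mono) auto
    also have "\<dots> = y ^ n * x ^ m"
      using that by (simp add: power_mult_distrib flip: power_add)
    finally have "(x ^ n * y ^ m) / ((\<Prod>i = 1..n. \<mu> i) * (\<Prod>i = 1..m. \<mu> i))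
        \<le> (y ^ n * x ^ m) / ((\<Prod>i = 1..n. \<mu> i) * (\<Prod>i = 1..m. \<mu> i))"
      using pos that
      by (intro divide_right_mono mult_nonneg_nonneg prod_nonneg) (auto intro: less_imp_le)
    then show ?thesis by (simp add: D_def v_def)
  qed
  have anti: "D m n = - D n m" for m n by (simp add: D_def mult.commute)
  \<comment> \<open>Both factors change sign when \<open>n\<close> and \<open>m\<close> are
    exchanged, so the case \<open>m \<le> n\<close> decides.\<close>
  have "0 \<le> (b n - b m) * D n m" if "n \<le> c" "m \<le> c" for n m
  proof (cases "m \<le> n")
    case True
    then show ?thesis using D_nonneg b that by simp
  next
    case False
    then show ?thesis
      using D_nonneg[of n m] b[of n m] anti[of n m] that
      by (intro mult_nonpos_nonpos) auto
  qed
  then have "0 \<le> (\<Sum>n = 0..c. \<Sum>m = 0..c. (b n - b m) * D n m)"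
    by (intro sum_nonneg) auto
  also have "\<dots> = (\<Sum>n = 0..c. \<Sum>m = 0..c. b n * D n m) + (\<Sum>n = 0..c. \<Sum>m = 0..c. b m * D m n)"
    by (simp add: D_def algebra_simps flip: sum.distrib)
  also have "(\<Sum>n = 0..c. \<Sum>m = 0..c. b m * D m n) = (\<Sum>n = 0..c. \<Sum>m = 0..c. b n * D n m)"
    by (rule sum.swap)
  finally have "0 \<le> (\<Sum>n = 0..c. \<Sum>m = 0..c. b n * D n m)" by simp
  also have "\<dots> = (\<Sum>n = 0..c. b n * v y n) * (\<Sum>m = 0..c. v x m)
                - (\<Sum>n = 0..c. b n * v x n) * (\<Sum>m = 0..c. v y m)"
    by (simp add: sum_product D_def right_diff_distrib sum_subtractf mult.assoc)
  finally have "(\<Sum>n = 0..c. b n * v x n) * (\<Sum>m = 0..c. v y m)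
      \<le> (\<Sum>n = 0..c. b n * v y n) * (\<Sum>m = 0..c. v x m)" by simp
  moreover have "0 < (\<Sum>n = 0..c. v x n)" "0 < (\<Sum>n = 0..c. v y n)"
    unfolding v_def using order_trans[OF x] x pos by (blast intro: birth_death_sum_pos)+
  ultimately have "(\<Sum>n = 0..c. b n * v x n) / (\<Sum>n = 0..c. v x n)
      \<le> (\<Sum>n = 0..c. b n * v y n) / (\<Sum>n = 0..c. v y n)"
    by (simp add: divide_simps)
  then show ?thesis
    unfolding birth_death_def v_def[symmetric] by (simp add: sum_divide_distrib)
qed

theorem theorem4p1:
  fixes c1 c2 :: nat and q1 q2 l :: real
  assumes "1 \<le> c1" and "1 \<le> c2" and "0 < q1" and "0 < q2" and "0 < l"
  shows "\<exists>!\<theta>::real. \<theta> \<in> {0..l} \<and> \<theta> = l * (1 - P1 c1 c2 q1 q2 l \<theta> c1)"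
proof -
  define b where "b n = P12 c1 c2 q1 q2 l c1 n" for n
  define \<mu> where "\<mu> i = real i * g2 c2 q2 i" for i
  define f where "f \<theta> = P1 c1 c2 q1 q2 l \<theta> c1" for \<theta>
  have f_eq: "f \<theta> = (\<Sum>n = 0..c2. b n * birth_death c2 (\<theta> / q2) \<mu> n)" for \<theta>
    by (simp add: f_def P1_def b_def P2_def P2_zero_def birth_death_def \<mu>_def
        sum.atLeast_Suc_atMost divide_inverse)
  have \<mu>: "0 < \<mu> i" if "1 \<le> i" "i \<le> c2" for i
    using that assms g2_pos by (simp add: \<mu>_def)
  have b_eq: "b n = birth_death c1 (l / q1) (\<lambda>i. real i * g1 c1 c2 q1 q2 i n) c1" for n
    by (simp add: b_def P12_def P12_zero_def birth_death_def sum.atLeast_Suc_atMost divide_inverse)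
  have rate_pos: "0 < real i * g1 c1 c2 q1 q2 i n" if "1 \<le> i" "n \<le> c2" for i n
    using that assms g1_pos by simp
  have b01: "0 \<le> b n" "b n \<le> 1" if "n \<le> c2" for n
    unfolding b_eq using assms that rate_pos
    by (auto intro!: birth_death_nonneg birth_death_le_1)
  have b_mono: "b m \<le> b n" if "m \<le> n" "n \<le> c2" for m n
    unfolding b_eq using assms that rate_pos g1_antimono
    by (intro birth_death_full_mono) (auto intro!: mult_left_mono)
  have nonneg: "0 \<le> birth_death c2 (\<theta> / q2) \<mu> n" if "0 \<le> \<theta>" "n \<le> c2" for \<theta> n
    using assms that \<mu> by (intro birth_death_nonneg) auto
  have f_nonneg: "0 \<le> f \<theta>" if "0 \<le> \<theta>" for \<theta>
    unfolding f_eq using that b01 nonneg by (intro sum_nonneg mult_nonneg_nonneg) auto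
  have f_le_1: "f \<theta> \<le> 1" if "0 \<le> \<theta>" for \<theta>
  proof -
    have "f \<theta> \<le> (\<Sum>n = 0..c2. birth_death c2 (\<theta> / q2) \<mu> n)"
      unfolding f_eq using that b01 nonneg by (intro sum_mono mult_left_le_one_le) auto
    also have "\<dots> = 1" using assms that \<mu> by (intro sum_birth_death) auto
    finally show ?thesis .
  qed
  have f_mono: "f \<theta> \<le> f \<theta>'" if "0 \<le> \<theta>" "\<theta> \<le> \<theta>'" for \<theta> \<theta>'
    unfolding f_eq using assms that \<mu> b_mono
    by (intro birth_death_mean_mono divide_right_mono) auto
  have "continuous_on {0..l} (\<lambda>\<theta>. birth_death c2 (\<theta> / q2) \<mu> n)" for n
    using \<mu> assms
    by (intro continuous_on_compose2[OF continuous_on_birth_death] continuous_intros) auto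
  then have "continuous_on {0..l} f"
    unfolding f_eq[abs_def] by (intro continuous_intros)
  \<comment> \<open>At 0 the left-hand side is \<open>- l * (1 - f 0)\<close>, nonpositive since
    \<open>f 0 \<le> 1\<close>; at \<open>l\<close> it is \<open>l * f l\<close>, which is
    nonnegative.\<close>
  then have "\<exists>\<theta>\<ge>0. \<theta> \<le> l \<and> \<theta> - l * (1 - f \<theta>) = 0"
    using assms f_nonneg[of l] f_le_1[of 0] by (intro IVT' continuous_intros) auto
  then obtain \<theta> where \<theta>: "\<theta> \<in> {0..l}" "\<theta> = l * (1 - f \<theta>)" by auto
  \<comment> \<open>Strictness comes from the identity term alone, so weak monotonicity of
    \<open>f\<close> suffices for uniqueness.\<close>
  have less: "\<theta>' - l * (1 - f \<theta>') < \<theta>'' - l * (1 - f \<theta>'')" if "0 \<le> \<theta>'" "\<theta>' < \<theta>''" for \<theta>' \<theta>''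
  proof -
    have "l * f \<theta>' \<le> l * f \<theta>''" using that assms f_mono by simp
    then show ?thesis using that(2) by (simp add: right_diff_distrib)
  qed
  show ?thesis
  proof (rule ex1I[of _ \<theta>])
    show "\<theta> \<in> {0..l} \<and> \<theta> = l * (1 - P1 c1 c2 q1 q2 l \<theta> c1)" using \<theta> by (simp add: f_def)
  next
    fix \<theta>' assume "\<theta>' \<in> {0..l} \<and> \<theta>' = l * (1 - P1 c1 c2 q1 q2 l \<theta>' c1)"
    then have "\<theta>' \<in> {0..l}" "\<theta>' = l * (1 - f \<theta>')" by (simp_all add: f_def)
    then show "\<theta>' = \<theta>" using \<theta> less[of \<theta> \<theta>'] less[of \<theta>' \<theta>] by force
  qed
qed

end
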